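(* For all $c_1,c_2\in\mathbb{R}$, all $(u,v)\in\mathbb{R}^2\setminus(-\infty,0]^2$ and all $\rho\in(-1,1]$, $$\mathbb{P}\{W_1(1)>u+c_1,\ W_2(1)>v+c_2\}\ \le\ \psi(u,v)\ \le\ \frac{\mathbb{P}\{W_1(1)>u+c_1,\ W_2(1)>v+c_2\}}{\mathbb{P}\{W_1(1)>\max(c_1,0),\ W_2(1)>\max(c_2,0)\}}.$$
   Context: $B_1,B_2$ are two independent standard Brownian motions and $(W_1(t),W_2(t))_{t\ge0}$ has the same law as $(B_1(t),\ \rho B_1(t)+\sqrt{1-\rho^2}\,B_2(t))_{t\ge0}$. For real $u,v$, $$\psi(u,v)=\mathbb{P}\left\{\exists\, t\in[0,1]:\ W_1(t)-c_1t>u,\ W_2(t)-c_2t>v\right\}.$$ *)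

theory Defs
  imports "HOL-Probability.Probability"
begin

text \<open>
  Processes are indexed by real time, of which only $t \ge 0$ matters. All sample paths, not merely
  almost all, are continuous, so events such as the crossing event in \<open>psi\<close> are measurable without
  completing the probability space.
\<close>

definition continuous_process :: "'a measure \<Rightarrow> (real \<Rightarrow> 'a \<Rightarrow> 'b::topological_space) \<Rightarrow> bool" where
  "continuous_process M X \<longleftrightarrow>
     prob_space M \<and>
     (\<forall>t\<ge>0. X t \<in> borel_measurable M) \<and>
     (\<forall>\<omega>\<in>space M. continuous_on {0..} (\<lambda>t. X t \<omega>))"

abbreviation path_space :: "(real \<Rightarrow> 'b::topological_space) measure" where
  "path_space \<equiv> PiM {0..} (\<lambda>_. borel)"

abbreviation sample_path :: "(real \<Rightarrow> 'a \<Rightarrow> 'b) \<Rightarrow> 'a \<Rightarrow> real \<Rightarrow> 'b" where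
  "sample_path X \<omega> \<equiv> (\<lambda>t\<in>{0..}. X t \<omega>)"

definition process_law ::
    "'a measure \<Rightarrow> (real \<Rightarrow> 'a \<Rightarrow> 'b::topological_space) \<Rightarrow> (real \<Rightarrow> 'b) measure" where
  "process_law M X = distr M path_space (sample_path X)"

definition standard_brownian_motion :: "'a measure \<Rightarrow> (real \<Rightarrow> 'a \<Rightarrow> real) \<Rightarrow> bool" where
  "standard_brownian_motion M B \<longleftrightarrow>
     continuous_process M B \<and>
     (AE \<omega> in M. B 0 \<omega> = 0) \<and>
     (\<forall>(n::nat) \<tau>. 0 \<le> \<tau> 0 \<longrightarrow> mono \<tau> \<longrightarrow>
        prob_space.indep_vars M (\<lambda>_. borel) (\<lambda>i \<omega>. B (\<tau> (Suc i)) \<omega> - B (\<tau> i) \<omega>) {..<n}) \<and>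
     (\<forall>s t. 0 \<le> s \<longrightarrow> s < t \<longrightarrow>
        distributed M lborel (\<lambda>\<omega>. B t \<omega> - B s \<omega>) (normal_density 0 (sqrt (t - s))))"

text \<open>Independence of the whole processes, not just of their values at each fixed time.\<close>

definition indep_processes ::
    "'a measure \<Rightarrow> (real \<Rightarrow> 'a \<Rightarrow> real) \<Rightarrow> (real \<Rightarrow> 'a \<Rightarrow> real) \<Rightarrow> bool" where
  "indep_processes M X Y \<longleftrightarrow>
     prob_space.indep_var M path_space (sample_path X) path_space (sample_path Y)"

definition psi ::
    "'a measure \<Rightarrow> (real \<Rightarrow> 'a \<Rightarrow> real) \<Rightarrow> (real \<Rightarrow> 'a \<Rightarrow> real) \<Rightarrow> real \<Rightarrow> real \<Rightarrow> real \<Rightarrow> real \<Rightarrow> real" where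
  "psi N W1 W2 c1 c2 u v =
     \<P>(\<omega> in N. \<exists>t\<in>{0..1}. W1 t \<omega> - c1 * t > u \<and> W2 t \<omega> - c2 * t > v)"

end

theory Submission imports Defs begin

text \<open>
  If the drifted process first enters the quadrant at time $t < 1$, the increment over $[t,1]$ is
  independent of the past, and by Brownian scaling it keeps the process in the quadrant up to time
  $1$ with probability
  $P(W_1(1) > c_1\sqrt{1-t},\, W_2(1) > c_2\sqrt{1-t}) \ge P(W_1(1) > \max(c_1,0),\, W_2(1) > \max(c_2,0))$.
  Summing over the first entrance time gives the upper bound. Stopping times are avoided: the
  quadrant is open and paths are continuous, so crossing may be tested at rational times below $1$,
  and these are exhausted by finite sets of times.
\<close>

section \<open>Independence of the past from a later increment\<close>

text \<open>Together the three hypotheses make \<open>U1\<close>, \<open>V1\<close>,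
  \<open>U2\<close>, \<open>V2\<close> mutually independent, so they may be regrouped. It is enough
  to check the product formula on preimages of measurable rectangles, an intersection-stable
  generator of the sigma-algebra of each pair. In the application \<open>U\<close> is the past and
  \<open>V\<close> the increment of each motion.\<close>

lemma (in prob_space) indep_var_pair_interchange:
  fixes S1 S2 T1 T2 :: "'b measure"
  assumes ind: "indep_var (S1 \<Otimes>\<^sub>M T1) (\<lambda>\<omega>. (U1 \<omega>, V1 \<omega>)) (S2 \<Otimes>\<^sub>M T2) (\<lambda>\<omega>. (U2 \<omega>, V2 \<omega>))"
    and ind1: "indep_var S1 U1 T1 V1" and ind2: "indep_var S2 U2 T2 V2"
  shows "indep_var (S1 \<Otimes>\<^sub>M S2) (\<lambda>\<omega>. (U1 \<omega>, U2 \<omega>)) (T1 \<Otimes>\<^sub>M T2) (\<lambda>\<omega>. (V1 \<omega>, V2 \<omega>))"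
proof -
  note rv [measurable] = indep_var_rv1[OF ind1] indep_var_rv2[OF ind1]
    indep_var_rv1[OF ind2] indep_var_rv2[OF ind2]
  define rect where "rect S T X Y = {(\<lambda>\<omega>. (X \<omega>, Y \<omega>)) -` A \<inter> space M |A. A \<in> {a \<times> b |a b. a \<in> sets S \<and> b \<in> sets T}}"
    for S T :: "'b measure" and X Y
  have generate: "{(\<lambda>\<omega>. (X \<omega>, Y \<omega>)) -` A \<inter> space M |A. A \<in> sets (S \<Otimes>\<^sub>M T)} = sigma_sets (space M) (rect S T X Y)"
    if "X \<in> measurable M S" "Y \<in> measurable M T"
    for S T :: "'b measure" and X Y
    unfolding sets_pair_measure rect_def
    by (rule sigma_sets_vimage_commute) (use that in \<open>auto dest: measurable_space\<close>)
  have subset: "rect S T X Y \<subseteq> Pow (space M)" for S T :: "'b measure" and X Y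
    by (auto simp: rect_def)
  have stable: "Int_stable (rect S T X Y)" for S T :: "'b measure" and X Y
  proof (rule Int_stableI)
    fix a b assume "a \<in> rect S T X Y" "b \<in> rect S T X Y"
    then obtain P Q P' Q' where *: "P \<in> sets S" "P' \<in> sets S" "Q \<in> sets T" "Q' \<in> sets T"
      "a = (\<lambda>\<omega>. (X \<omega>, Y \<omega>)) -` (P \<times> Q) \<inter> space M" "b = (\<lambda>\<omega>. (X \<omega>, Y \<omega>)) -` (P' \<times> Q') \<inter> space M"
      unfolding rect_def by blast
    then have "a \<inter> b = (\<lambda>\<omega>. (X \<omega>, Y \<omega>)) -` ((P \<inter> P') \<times> (Q \<inter> Q')) \<inter> space M" by auto
    with * show "a \<inter> b \<in> rect S T X Y" unfolding rect_def by blast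
  qed
  have "indep_set (rect S1 S2 U1 U2) (rect T1 T2 V1 V2)"
  proof (rule indep_setI)
    show "rect S1 S2 U1 U2 \<subseteq> events" "rect T1 T2 V1 V2 \<subseteq> events"
      unfolding rect_def by auto
    fix a b assume "a \<in> rect S1 S2 U1 U2" "b \<in> rect T1 T2 V1 V2"
    then obtain P Q R S where sets [measurable]: "P \<in> sets S1" "Q \<in> sets S2" "R \<in> sets T1" "S \<in> sets T2"
      and a: "a = (\<lambda>\<omega>. (U1 \<omega>, U2 \<omega>)) -` (P \<times> Q) \<inter> space M"
      and b: "b = (\<lambda>\<omega>. (V1 \<omega>, V2 \<omega>)) -` (R \<times> S) \<inter> space M"
      unfolding rect_def by blast
    \<comment> \<open>The fourfold product formula. Putting a whole space into a slot gives that
      slot probability 1, so the formula covers \<open>a\<close>, \<open>b\<close> and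
      \<open>a \<inter> b\<close> alike.\<close>
    have joint: "prob {\<omega>\<in>space M. U1 \<omega> \<in> P' \<and> V1 \<omega> \<in> R' \<and> U2 \<omega> \<in> Q' \<and> V2 \<omega> \<in> S'} =
        (prob (U1 -` P' \<inter> space M) * prob (V1 -` R' \<inter> space M)) *
        (prob (U2 -` Q' \<inter> space M) * prob (V2 -` S' \<inter> space M))"
      if "P' \<in> sets S1" "Q' \<in> sets S2" "R' \<in> sets T1" "S' \<in> sets T2" for P' Q' R' S'
    proof -
      have "prob ((\<lambda>\<omega>. ((U1 \<omega>, V1 \<omega>), (U2 \<omega>, V2 \<omega>))) -` ((P' \<times> R') \<times> (Q' \<times> S')) \<inter> space M) =
          prob ((\<lambda>\<omega>. (U1 \<omega>, V1 \<omega>)) -` (P' \<times> R') \<inter> space M) * prob ((\<lambda>\<omega>. (U2 \<omega>, V2 \<omega>)) -` (Q' \<times> S') \<inter> space M)"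
        using that by (intro indep_varD[OF ind]) auto
      also have "\<dots> = (prob (U1 -` P' \<inter> space M) * prob (V1 -` R' \<inter> space M)) *
          (prob (U2 -` Q' \<inter> space M) * prob (V2 -` S' \<inter> space M))"
        using that by (simp add: indep_varD[OF ind1] indep_varD[OF ind2])
      finally show ?thesis by (simp add: vimage_def Int_def conj_commute conj_assoc)
    qed
    have prob1: "prob (X -` space N \<inter> space M) = 1" if "X \<in> measurable M N" for X and N :: "'b measure"
    proof -
      have "X -` space N \<inter> space M = space M" using measurable_space[OF that] by auto
      then show ?thesis by (simp add: prob_space)
    qed
    note in_space = rv[THEN measurable_space]
    have "a = {\<omega>\<in>space M. U1 \<omega> \<in> P \<and> V1 \<omega> \<in> space T1 \<and> U2 \<omega> \<in> Q \<and> V2 \<omega> \<in> space T2}"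
      using in_space by (auto simp: a)
    moreover have "b = {\<omega>\<in>space M. U1 \<omega> \<in> space S1 \<and> V1 \<omega> \<in> R \<and> U2 \<omega> \<in> space S2 \<and> V2 \<omega> \<in> S}"
      using in_space by (auto simp: b)
    moreover have "a \<inter> b = {\<omega>\<in>space M. U1 \<omega> \<in> P \<and> V1 \<omega> \<in> R \<and> U2 \<omega> \<in> Q \<and> V2 \<omega> \<in> S}"
      by (auto simp: a b)
    ultimately show "prob (a \<inter> b) = prob a * prob b"
      by (simp add: joint prob1)
  qed
  then have "indep_set (sigma_sets (space M) (rect S1 S2 U1 U2)) (sigma_sets (space M) (rect T1 T2 V1 V2))"
    by (rule indep_set_sigma_sets[OF _ stable stable])
  then show ?thesis
    unfolding indep_var_eq by (simp add: generate sigma_sets_sigma_sets_eq[OF subset])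
qed

text \<open>
  \<open>indep_var\<close> requires both variables to have the same type, so the single increment is
  wrapped as a function on the one-point set \<open>{r}\<close>.
\<close>

lemma brownian_motion_past_indep:
  assumes bm: "standard_brownian_motion M B"
    and S: "finite S" "S \<subseteq> {0..t}" and t: "0 \<le> t" "t \<le> r"
  shows "prob_space.indep_var M
    (PiM S (\<lambda>_. borel)) (\<lambda>\<omega>. \<lambda>s\<in>S. B s \<omega> - B 0 \<omega>)
    (PiM {r} (\<lambda>_. borel)) (\<lambda>\<omega>. \<lambda>s\<in>{r}. B s \<omega> - B t \<omega>)"
proof -
  interpret prob_space M using bm by (simp add: standard_brownian_motion_def continuous_process_def)
  \<comment> \<open>Listing 0 and \<open>t\<close> along with \<open>S\<close> makes the telescoping
    sums start at \<open>B 0\<close> and places \<open>t\<close> last, at index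
    \<open>m\<close>.\<close>
  define xs where "xs = sorted_list_of_set (insert 0 (insert t S))"
  have set_xs: "set xs = insert 0 (insert t S)"
    unfolding xs_def by (rule set_sorted_list_of_set) (use S(1) in simp)
  have srt: "sorted xs" unfolding xs_def by (rule sorted_sorted_list_of_set)
  have ne: "xs \<noteq> []" using set_xs by auto
  define m where "m = length xs - 1"
  have len: "length xs = Suc m" using ne by (simp add: m_def)
  \<comment> \<open>The sequence stays at \<open>r\<close> after index \<open>m\<close>, which keeps
    it monotone on all naturals and makes increment number \<open>m\<close> equal to
    \<open>B r - B t\<close>. The case \<open>t = r\<close> is covered, as \<open>\<tau>\<close> may
    repeat values.\<close>
  define \<tau> where "\<tau> i = (if i \<le> m then xs ! i else r)" for i
  have in_xs: "xs ! i \<in> {0..t}" if "i \<le> m" for i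
    using nth_mem[of i xs] that len set_xs S(2) t by auto
  have "mono \<tau>"
    using in_xs t(2) srt len by (fastforce simp: mono_def \<tau>_def sorted_iff_nth_mono intro: order_trans)
  have idx: "\<exists>j\<le>m. s = xs ! j" if "s \<in> insert 0 (insert t S)" for s
    using that len unfolding set_xs[symmetric] by (metis in_set_conv_nth less_Suc_eq_le)
  have \<tau>0: "\<tau> 0 = 0"
  proof -
    obtain j where "j \<le> m" "0 = xs ! j" using idx by blast
    then have "xs ! 0 \<le> 0" using sorted_nth_mono[OF srt, of 0 j] len by simp
    then show ?thesis using in_xs[of 0] by (simp add: \<tau>_def)
  qed
  have \<tau>m: "\<tau> m = t"
  proof -
    obtain j where "j \<le> m" "t = xs ! j" using idx by blast
    then have "t \<le> xs ! m" using sorted_nth_mono[OF srt, of j m] len by simp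
    then show ?thesis using in_xs[of m] by (simp add: \<tau>_def)
  qed
  obtain J where J: "\<And>s. s \<in> S \<Longrightarrow> J s \<le> m \<and> s = \<tau> (J s)"
  proof -
    have "\<forall>s\<in>S. \<exists>j. j \<le> m \<and> s = \<tau> j" using idx by (auto simp: \<tau>_def)
    then show ?thesis using that by metis
  qed
  let ?I = "\<lambda>i \<omega>. B (\<tau> (Suc i)) \<omega> - B (\<tau> i) \<omega>"
  have "indep_vars (\<lambda>_. borel) ?I {..<Suc m}"
    using bm \<tau>0 \<open>mono \<tau>\<close> by (simp add: standard_brownian_motion_def)
  then have "indep_var (PiM {..<m} (\<lambda>_. borel)) (\<lambda>\<omega>. \<lambda>i\<in>{..<m}. ?I i \<omega>)
      (PiM {m} (\<lambda>_. borel)) (\<lambda>\<omega>. \<lambda>i\<in>{m}. ?I i \<omega>)"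
    by (rule indep_var_restrict) auto
  \<comment> \<open>The value at \<open>s\<close> minus \<open>B 0\<close> is the sum of the first
    \<open>J s\<close> increments. Since \<open>J s \<le> m\<close>, the past is a function of
    increments below \<open>m\<close>, disjoint from increment \<open>m\<close>.\<close>
  then have "indep_var (PiM S (\<lambda>_. borel)) ((\<lambda>x. \<lambda>s\<in>S. \<Sum>i<J s. x i) \<circ> (\<lambda>\<omega>. \<lambda>i\<in>{..<m}. ?I i \<omega>))
      (PiM {r} (\<lambda>_. borel)) ((\<lambda>x. \<lambda>s\<in>{r}. x m) \<circ> (\<lambda>\<omega>. \<lambda>i\<in>{m}. ?I i \<omega>))"
  proof (rule indep_var_compose)
    show "(\<lambda>x. \<lambda>s\<in>S. \<Sum>i<J s. x i) \<in> measurable (PiM {..<m} (\<lambda>_. borel)) (PiM S (\<lambda>_. borel :: real measure))"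
      using J by (intro measurable_restrict borel_measurable_sum measurable_component_singleton) force
  qed auto
  moreover have "(\<lambda>x. \<lambda>s\<in>S. \<Sum>i<J s. x i) \<circ> (\<lambda>\<omega>. \<lambda>i\<in>{..<m}. ?I i \<omega>) = (\<lambda>\<omega>. \<lambda>s\<in>S. B s \<omega> - B 0 \<omega>)"
  proof (rule ext, unfold comp_def, rule restrict_ext)
    fix \<omega> s assume "s \<in> S"
    then have "(\<Sum>i<J s. (\<lambda>i\<in>{..<m}. ?I i \<omega>) i) = (\<Sum>i<J s. ?I i \<omega>)"
      using J by (intro sum.cong) force+
    also have "\<dots> = B s \<omega> - B 0 \<omega>"
      using J[OF \<open>s \<in> S\<close>] \<tau>0 sum_lessThan_telescope[of "\<lambda>i. B (\<tau> i) \<omega>"] by simp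
    finally show "(\<Sum>i<J s. (\<lambda>i\<in>{..<m}. ?I i \<omega>) i) = B s \<omega> - B 0 \<omega>" .
  qed
  moreover have "(\<lambda>x. \<lambda>s\<in>{r}. x m) \<circ> (\<lambda>\<omega>. \<lambda>i\<in>{m}. ?I i \<omega>) = (\<lambda>\<omega>. \<lambda>s\<in>{r}. B s \<omega> - B t \<omega>)"
  proof (rule ext, unfold comp_def, rule restrict_ext)
    show "(\<lambda>i\<in>{m}. ?I i \<omega>) m = B s \<omega> - B t \<omega>" if "s \<in> {r}" for \<omega> s
      using that \<tau>m by (simp add: \<tau>_def)
  qed
  ultimately show ?thesis by simp
qed

section \<open>Increments of two independent Brownian motions\<close>

locale independent_brownian_motions = prob_space M
  for M :: "'a measure" and B1 B2 :: "real \<Rightarrow> 'a \<Rightarrow> real" +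
  assumes bm1: "standard_brownian_motion M B1"
    and bm2: "standard_brownian_motion M B2"
    and indep: "indep_processes M B1 B2"
begin

lemma B_measurable:
  assumes "0 \<le> t"
  shows "B1 t \<in> borel_measurable M" "B2 t \<in> borel_measurable M"
  using bm1 bm2 assms by (auto simp: standard_brownian_motion_def continuous_process_def)

lemma indep_var_compose_paths:
  assumes "f \<in> measurable path_space K" "g \<in> measurable path_space L"
    and "\<And>\<omega>. f (sample_path B1 \<omega>) = F \<omega>" "\<And>\<omega>. g (sample_path B2 \<omega>) = G \<omega>"
  shows "indep_var K F L G"
  using indep_var_compose[OF indep[unfolded indep_processes_def] assms(1,2)] assms(3,4)
  by (simp add: comp_def)

text \<open>Past and increment of one motion form a functional of its path, so these pairs are
  independent across the two motions. Within each motion the past is independent of the increment,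
  and the interchange lemma then regroups the four pieces.\<close>

lemma past_indep:
  assumes S: "finite S" "S \<subseteq> {0..t}" and t: "0 \<le> t" "t \<le> r"
  shows "indep_var
    (PiM S (\<lambda>_. borel) \<Otimes>\<^sub>M PiM S (\<lambda>_. borel))
    (\<lambda>\<omega>. (\<lambda>s\<in>S. B1 s \<omega> - B1 0 \<omega>, \<lambda>s\<in>S. B2 s \<omega> - B2 0 \<omega>))
    (PiM {r} (\<lambda>_. borel) \<Otimes>\<^sub>M PiM {r} (\<lambda>_. borel))
    (\<lambda>\<omega>. (\<lambda>s\<in>{r}. B1 s \<omega> - B1 t \<omega>, \<lambda>s\<in>{r}. B2 s \<omega> - B2 t \<omega>))"
proof (rule indep_var_pair_interchange)
  let ?f = "\<lambda>x :: real \<Rightarrow> real. (\<lambda>s\<in>S. x s - x 0, \<lambda>s\<in>{r}. x s - x t)"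
  have f: "?f \<in> measurable path_space (PiM S (\<lambda>_. borel) \<Otimes>\<^sub>M PiM {r} (\<lambda>_. borel))"
    using S t
    by (intro measurable_Pair measurable_restrict borel_measurable_diff measurable_component_singleton) auto
  show "indep_var
    (PiM S (\<lambda>_. borel) \<Otimes>\<^sub>M PiM {r} (\<lambda>_. borel))
    (\<lambda>\<omega>. (\<lambda>s\<in>S. B1 s \<omega> - B1 0 \<omega>, \<lambda>s\<in>{r}. B1 s \<omega> - B1 t \<omega>))
    (PiM S (\<lambda>_. borel) \<Otimes>\<^sub>M PiM {r} (\<lambda>_. borel))
    (\<lambda>\<omega>. (\<lambda>s\<in>S. B2 s \<omega> - B2 0 \<omega>, \<lambda>s\<in>{r}. B2 s \<omega> - B2 t \<omega>))"
    using S(2) t by (intro indep_var_compose_paths[OF f f]) (auto intro!: restrict_ext)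
qed (rule brownian_motion_past_indep[OF bm1 S t] brownian_motion_past_indep[OF bm2 S t])+

lemma distr_increment:
  assumes "standard_brownian_motion M B" "0 \<le> s" "s < t"
  shows "distr M borel (\<lambda>\<omega>. (B t \<omega> - B s \<omega>) / sqrt (t - s)) = density lborel std_normal_density"
proof -
  have "distributed M lborel (\<lambda>\<omega>. B t \<omega> - B s \<omega>) (normal_density 0 (sqrt (t - s)))"
    using assms by (simp add: standard_brownian_motion_def)
  then have "distributed M lborel (\<lambda>\<omega>. (B t \<omega> - B s \<omega>) / sqrt (t - s)) std_normal_density"
    using normal_standard_normal_convert[of "sqrt (t - s)" "\<lambda>\<omega>. B t \<omega> - B s \<omega>" 0] assms by simp
  then have "distr M lborel (\<lambda>\<omega>. (B t \<omega> - B s \<omega>) / sqrt (t - s)) = density lborel std_normal_density"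
    by (rule distributed_distr_eq_density)
  then show ?thesis
    by (metis (no_types) distr_cong sets_lborel)
qed

lemma indep_increments:
  assumes "0 \<le> s" "0 \<le> t"
  shows "indep_var borel (\<lambda>\<omega>. (B1 t \<omega> - B1 s \<omega>) / c) borel (\<lambda>\<omega>. (B2 t \<omega> - B2 s \<omega>) / c)"
  using assms
  by (intro indep_var_compose_paths[where f = "\<lambda>x. (x t - x s) / c" and g = "\<lambda>x. (x t - x s) / c"])
     (auto intro!: borel_measurable_divide borel_measurable_diff measurable_component_singleton)

text \<open>Brownian scaling in the form used below: the normalized law is the same for every
  interval, so increments over \<open>[t,1]\<close> can be compared with those over
  \<open>[0,1]\<close>.\<close>

lemma joint_distr_increments:
  assumes "0 \<le> s" "s < t"
  shows "distr M (borel \<Otimes>\<^sub>M borel)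
      (\<lambda>\<omega>. ((B1 t \<omega> - B1 s \<omega>) / sqrt (t - s), (B2 t \<omega> - B2 s \<omega>) / sqrt (t - s))) =
    density lborel std_normal_density \<Otimes>\<^sub>M density lborel std_normal_density"
  using indep_increments[of s t "sqrt (t - s)"] assms
  by (simp add: indep_var_distribution_eq distr_increment[OF bm1] distr_increment[OF bm2])

text \<open>Dividing the increment over \<open>[t,1]\<close> by \<open>h = sqrt (1 - t)\<close>
  turns the threshold \<open>c * (1 - t)\<close> into \<open>c * h\<close>. As
  \<open>0 < h \<le> 1\<close>, this is at most \<open>max c 0\<close>, whatever the sign of
  \<open>c\<close>; hence the maxima in the denominator of the theorem.\<close>

lemma increment_cone_bound:
  assumes t: "0 \<le> t" "t < 1"
  shows "\<P>(\<omega> in M. B1 1 \<omega> - B1 0 \<omega> > max c1 0 \<and>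
      \<rho> * (B1 1 \<omega> - B1 0 \<omega>) + \<sigma> * (B2 1 \<omega> - B2 0 \<omega>) > max c2 0)
    \<le> \<P>(\<omega> in M. B1 1 \<omega> - B1 t \<omega> > c1 * (1 - t) \<and>
      \<rho> * (B1 1 \<omega> - B1 t \<omega>) + \<sigma> * (B2 1 \<omega> - B2 t \<omega>) > c2 * (1 - t))"
proof -
  \<comment> \<open>The shifted quadrant is pulled back to the coordinates of the independent
    motions, where the normalized law is a product.\<close>
  define G :: "(real \<times> real) set" where
    "G = {z \<in> space (borel \<Otimes>\<^sub>M borel). fst z > max c1 0 \<and> \<rho> * fst z + \<sigma> * snd z > max c2 0}"
  have G [measurable]: "G \<in> sets (borel \<Otimes>\<^sub>M borel)" unfolding G_def by measurable
  note [measurable] = B_measurable[of 1, simplified] B_measurable[of 0, simplified] B_measurable[OF t(1)]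
  define Z where "Z s \<omega> = ((B1 1 \<omega> - B1 s \<omega>) / sqrt (1 - s), (B2 1 \<omega> - B2 s \<omega>) / sqrt (1 - s))" for s \<omega>
  have law: "prob (Z s -` G \<inter> space M) =
      measure (density lborel std_normal_density \<Otimes>\<^sub>M density lborel std_normal_density) G"
    if "0 \<le> s" "s < 1" for s
  proof -
    note [measurable] = B_measurable[OF that(1)]
    show ?thesis
      using joint_distr_increments[OF that, symmetric] by (simp add: measure_distr Z_def[abs_def])
  qed
  let ?h = "sqrt (1 - t)"
  have h: "0 < ?h" "?h \<le> 1" "?h * ?h = 1 - t" using t by auto
  have scale: "c * (1 - t) < x" if "max c 0 < x / ?h" for c x :: real
  proof -
    have "c * ?h \<le> max c 0"
    proof (cases "c \<ge> 0")
      case True then show ?thesis using h mult_left_le[of ?h c] by simp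
    next
      case False then show ?thesis using h by (simp add: mult_le_0_iff)
    qed
    then have "c * ?h < x / ?h" using that by linarith
    then show ?thesis using h by (simp add: pos_less_divide_eq mult.assoc)
  qed
  have "\<P>(\<omega> in M. B1 1 \<omega> - B1 0 \<omega> > max c1 0 \<and>
      \<rho> * (B1 1 \<omega> - B1 0 \<omega>) + \<sigma> * (B2 1 \<omega> - B2 0 \<omega>) > max c2 0) = prob (Z 0 -` G \<inter> space M)"
    by (intro arg_cong[where f = prob]) (auto simp: Z_def G_def space_pair_measure)
  also have "\<dots> = prob (Z t -` G \<inter> space M)"
    using law[of 0] law[of t] t by simp
  also have "\<dots> \<le> \<P>(\<omega> in M. B1 1 \<omega> - B1 t \<omega> > c1 * (1 - t) \<and>
      \<rho> * (B1 1 \<omega> - B1 t \<omega>) + \<sigma> * (B2 1 \<omega> - B2 t \<omega>) > c2 * (1 - t))"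
  proof (rule finite_measure_mono)
    show "Z t -` G \<inter> space M \<subseteq> {\<omega>\<in>space M. B1 1 \<omega> - B1 t \<omega> > c1 * (1 - t) \<and>
      \<rho> * (B1 1 \<omega> - B1 t \<omega>) + \<sigma> * (B2 1 \<omega> - B2 t \<omega>) > c2 * (1 - t)}"
      unfolding Z_def G_def
      by (auto intro!: scale simp del: max_less_iff_conj simp: add_divide_distrib)
  qed measurable
  finally show ?thesis .
qed

section \<open>Crossing at finitely or countably many times\<close>

text \<open>The crossing event splits into the disjoint events \<open>A t\<close> that
  \<open>t\<close> is the first crossing time in \<open>T\<close>. Each is independent of the event
  \<open>C t\<close> that the increment over \<open>[t,1]\<close> beats the remaining drift. The
  probability of \<open>C t\<close> is at least that of the corner event, and
  \<open>A t \<inter> C t\<close> forces the endpoint into the target quadrant.\<close>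

lemma finite_crossing_bound:
  fixes \<rho> \<sigma> c1 c2 u v :: real
  defines "X1 t \<omega> \<equiv> B1 t \<omega> - B1 0 \<omega>"
    and "X2 t \<omega> \<equiv> \<rho> * (B1 t \<omega> - B1 0 \<omega>) + \<sigma> * (B2 t \<omega> - B2 0 \<omega>)"
  assumes T: "finite T" "T \<subseteq> {0..<1}"
  shows "\<P>(\<omega> in M. \<exists>t\<in>T. X1 t \<omega> - c1 * t > u \<and> X2 t \<omega> - c2 * t > v)
      * \<P>(\<omega> in M. X1 1 \<omega> > max c1 0 \<and> X2 1 \<omega> > max c2 0)
    \<le> \<P>(\<omega> in M. X1 1 \<omega> > u + c1 \<and> X2 1 \<omega> > v + c2)"
    (is "?H * ?D \<le> prob ?F")
proof -
  \<comment> \<open>\<open>hit\<close> and \<open>first\<close> take paths as arguments so that they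
    apply both to full paths and to their restrictions to finitely many times.\<close>
  define hit where "hit x y t \<longleftrightarrow> x t - c1 * t > u \<and> \<rho> * x t + \<sigma> * y t - c2 * t > v"
    for x y :: "real \<Rightarrow> real" and t
  define first where "first S t x y \<longleftrightarrow> hit x y t \<and> \<not> (\<exists>s\<in>S. s < t \<and> hit x y s)" for S t x y
  define A where "A t = {\<omega>\<in>space M. first T t (\<lambda>s. B1 s \<omega> - B1 0 \<omega>) (\<lambda>s. B2 s \<omega> - B2 0 \<omega>)}" for t
  define C where "C t = {\<omega>\<in>space M. B1 1 \<omega> - B1 t \<omega> > c1 * (1 - t) \<and>
      \<rho> * (B1 1 \<omega> - B1 t \<omega>) + \<sigma> * (B2 1 \<omega> - B2 t \<omega>) > c2 * (1 - t)}" for t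
  have T0: "0 \<le> t" "t < 1" if "t \<in> T" for t using that T by auto
  have "A t \<in> events \<and> C t \<in> events \<and> prob (A t \<inter> C t) = prob (A t) * prob (C t)" if t: "t \<in> T" for t
  proof -
    define S where "S = {s\<in>T. s \<le> t}"
    have S: "finite S" "S \<subseteq> {0..t}" "t \<in> S" using T t by (auto simp: S_def)
    let ?P = "PiM S (\<lambda>_. borel) :: (real \<Rightarrow> real) measure"
    let ?Q = "PiM {1} (\<lambda>_. borel) :: (real \<Rightarrow> real) measure"
    define GA where "GA = {z \<in> space (?P \<Otimes>\<^sub>M ?P). first S t (fst z) (snd z)}"
    define GC where "GC = {z \<in> space (?Q \<Otimes>\<^sub>M ?Q). fst z 1 > c1 * (1 - t) \<and>
      \<rho> * fst z 1 + \<sigma> * snd z 1 > c2 * (1 - t)}"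
    have [measurable]: "(\<lambda>z. fst z s) \<in> borel_measurable (?P \<Otimes>\<^sub>M ?P)" "(\<lambda>z. snd z s) \<in> borel_measurable (?P \<Otimes>\<^sub>M ?P)"
      if "s \<in> S" for s
      using that by (auto intro!: measurable_compose[OF measurable_fst measurable_component_singleton]
        measurable_compose[OF measurable_snd measurable_component_singleton])
    have hitm [measurable]: "Measurable.pred (?P \<Otimes>\<^sub>M ?P) (\<lambda>z. hit (fst z) (snd z) s)" if "s \<in> S" for s
      unfolding hit_def using that by measurable
    have GA: "GA \<in> sets (?P \<Otimes>\<^sub>M ?P)"
      unfolding GA_def first_def using S by measurable
    have GC: "GC \<in> sets (?Q \<Otimes>\<^sub>M ?Q)"
      unfolding GC_def by measurable
    let ?U = "\<lambda>\<omega>. (\<lambda>s\<in>S. B1 s \<omega> - B1 0 \<omega>, \<lambda>s\<in>S. B2 s \<omega> - B2 0 \<omega>)"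
    let ?V = "\<lambda>\<omega>. (\<lambda>s\<in>{1}. B1 s \<omega> - B1 t \<omega>, \<lambda>s\<in>{1}. B2 s \<omega> - B2 t \<omega>)"
    have ind: "indep_var (?P \<Otimes>\<^sub>M ?P) ?U (?Q \<Otimes>\<^sub>M ?Q) ?V"
      using S T0[OF t] by (intro past_indep) auto
    \<comment> \<open>A first crossing at \<open>t\<close> involves only times of \<open>T\<close>
      up to \<open>t\<close>, all of which lie in \<open>S\<close>; the restricted past therefore
      decides \<open>A t\<close>.\<close>
    have "first S t (fst (?U \<omega>)) (snd (?U \<omega>)) =
        first T t (\<lambda>s. B1 s \<omega> - B1 0 \<omega>) (\<lambda>s. B2 s \<omega> - B2 0 \<omega>)" for \<omega>
      using S(3) by (auto simp: first_def hit_def S_def)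
    then have A_eq: "A t = ?U -` GA \<inter> space M"
      by (auto simp: A_def GA_def space_pair_measure space_PiM)
    have C_eq: "C t = ?V -` GC \<inter> space M"
      by (auto simp: C_def GC_def space_pair_measure space_PiM)
    have "A t \<inter> C t = (\<lambda>\<omega>. (?U \<omega>, ?V \<omega>)) -` (GA \<times> GC) \<inter> space M"
      unfolding A_eq C_eq by auto
    then show ?thesis
      using indep_varD[OF ind GA GC] measurable_sets[OF indep_var_rv1[OF ind] GA]
        measurable_sets[OF indep_var_rv2[OF ind] GC]
      by (simp add: A_eq C_eq)
  qed
  then have AC: "A t \<in> events" "C t \<in> events" "prob (A t \<inter> C t) = prob (A t) * prob (C t)"
    if "t \<in> T" for t using that by auto
  have disj: "disjoint_family_on A T"
    unfolding disjoint_family_on_def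
  proof (intro ballI impI)
    fix s t assume "s \<in> T" "t \<in> T" "s \<noteq> t"
    then show "A s \<inter> A t = {}" by (cases s t rule: linorder_cases) (auto simp: A_def first_def)
  qed
  have "{\<omega>\<in>space M. \<exists>t\<in>T. X1 t \<omega> - c1 * t > u \<and> X2 t \<omega> - c2 * t > v} = (\<Union>t\<in>T. A t)" (is "?L = _")
  proof
    show "?L \<subseteq> (\<Union>t\<in>T. A t)"
    proof
      fix \<omega> assume \<omega>: "\<omega> \<in> ?L"
      let ?hit = "hit (\<lambda>s. B1 s \<omega> - B1 0 \<omega>) (\<lambda>s. B2 s \<omega> - B2 0 \<omega>)"
      let ?K = "{t\<in>T. ?hit t}"
      have "finite ?K" "?K \<noteq> {}" using \<omega> T(1) by (auto simp: X1_def X2_def hit_def)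
      then have "Min ?K \<in> ?K" "\<And>s. s \<in> ?K \<Longrightarrow> Min ?K \<le> s" by (rule Min_in, simp)
      then have "\<omega> \<in> A (Min ?K)" "Min ?K \<in> T" using \<omega> by (fastforce simp: A_def first_def)+
      then show "\<omega> \<in> (\<Union>t\<in>T. A t)" by blast
    qed
  qed (auto simp: A_def first_def hit_def X1_def X2_def)
  then have "?H = (\<Sum>t\<in>T. prob (A t))"
    using AC disj T(1) by (simp add: finite_measure_finite_Union image_subset_iff)
  then have "?H * ?D = (\<Sum>t\<in>T. prob (A t) * ?D)"
    by (simp add: sum_distrib_right)
  also have "\<dots> \<le> (\<Sum>t\<in>T. prob (A t) * prob (C t))"
    using increment_cone_bound T0 unfolding C_def X1_def X2_def
    by (intro sum_mono mult_left_mono) auto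
  also have "\<dots> = (\<Sum>t\<in>T. prob (A t \<inter> C t))"
    using AC by simp
  also have "\<dots> = prob (\<Union>t\<in>T. A t \<inter> C t)"
  proof (rule finite_measure_finite_Union[symmetric])
    show "disjoint_family_on (\<lambda>t. A t \<inter> C t) T"
      using disj unfolding disjoint_family_on_def by blast
  qed (use AC T(1) in auto)
  also have "\<dots> \<le> prob ?F"
  proof (rule finite_measure_mono)
    note [measurable] = B_measurable[of 1, simplified] B_measurable[of 0, simplified]
    show "?F \<in> events" unfolding X1_def X2_def by measurable
    \<comment> \<open>At the crossing time \<open>X1 t > u + c1 * t\<close>, and the increment
      exceeds \<open>c1 * (1 - t)\<close>; the sum exceeds \<open>u + c1\<close>. The second
      coordinate is analogous.\<close>
    show "(\<Union>t\<in>T. A t \<inter> C t) \<subseteq> ?F"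
      by (auto simp: A_def C_def first_def hit_def X1_def X2_def algebra_simps)
  qed
  finally show ?thesis .
qed

text \<open>Continuity of the measure from below along an increasing exhaustion of \<open>T\<close>
  by finite sets; the finite bound is uniform in the set of times.\<close>

lemma countable_crossing_bound:
  fixes \<rho> \<sigma> c1 c2 u v :: real
  defines "X1 t \<omega> \<equiv> B1 t \<omega> - B1 0 \<omega>"
    and "X2 t \<omega> \<equiv> \<rho> * (B1 t \<omega> - B1 0 \<omega>) + \<sigma> * (B2 t \<omega> - B2 0 \<omega>)"
  assumes T: "countable T" "T \<subseteq> {0..<1}"
  shows "\<P>(\<omega> in M. \<exists>t\<in>T. X1 t \<omega> - c1 * t > u \<and> X2 t \<omega> - c2 * t > v)
      * \<P>(\<omega> in M. X1 1 \<omega> > max c1 0 \<and> X2 1 \<omega> > max c2 0)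
    \<le> \<P>(\<omega> in M. X1 1 \<omega> > u + c1 \<and> X2 1 \<omega> > v + c2)"
    (is "?H * ?D \<le> ?F")
proof (cases "T = {}")
  case False
  \<comment> \<open>\<open>from_nat_into\<close> enumerates \<open>T\<close> only if
    \<open>T\<close> is nonempty. For empty \<open>T\<close> the crossing probability is 0.\<close>
  define S where "S n = from_nat_into T ` {..n}" for n
  define E where "E n = {\<omega>\<in>space M. \<exists>t\<in>S n. X1 t \<omega> - c1 * t > u \<and> X2 t \<omega> - c2 * t > v}" for n :: nat
  have S: "finite (S n)" "S n \<subseteq> {0..<1}" for n
    using from_nat_into[OF False] T(2) by (auto simp: S_def)
  have "(\<Union>n. S n) = T"
    by (simp only: S_def image_UN[symmetric] UN_atMost_UNIV range_from_nat_into[OF False T(1)])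
  then have E_Un: "(\<Union>n. E n) = {\<omega>\<in>space M. \<exists>t\<in>T. X1 t \<omega> - c1 * t > u \<and> X2 t \<omega> - c2 * t > v}"
    unfolding E_def by blast
  have "E n \<in> events" for n
  proof -
    have "Measurable.pred M (\<lambda>\<omega>. X1 t \<omega> - c1 * t > u \<and> X2 t \<omega> - c2 * t > v)" if "t \<in> S n" for t
    proof -
      note [measurable] = B_measurable[of t] B_measurable[of 0, simplified]
      have "0 \<le> t" using S(2)[of n] that by auto
      then show ?thesis unfolding X1_def X2_def by measurable
    qed
    then show ?thesis unfolding E_def using S(1)[of n] by measurable
  qed
  then have "(\<lambda>n. prob (E n)) \<longlonglongrightarrow> ?H"
    unfolding E_Un[symmetric]
    by (intro finite_Lim_measure_incseq) (fastforce simp: incseq_def E_def S_def)+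
  then have "(\<lambda>n. prob (E n) * ?D) \<longlonglongrightarrow> ?H * ?D"
    by (rule tendsto_mult_right)
  moreover have "prob (E n) * ?D \<le> ?F" for n
    unfolding E_def X1_def X2_def by (rule finite_crossing_bound[OF S])
  ultimately show ?thesis by (intro LIMSEQ_le_const2) auto
qed simp

section \<open>Positivity of the denominator\<close>

text \<open>The region contains an open unit square, which two independent normal variables charge
  with positive probability. At \<rho> = -1 the conditions would read \<open>a < x\<close> and
  \<open>x < - b\<close>, which can be incompatible.\<close>

lemma orthant_prob_pos:
  assumes "-1 < \<rho>" "\<rho> \<le> 1"
  shows "0 < \<P>(\<omega> in M. B1 1 \<omega> - B1 0 \<omega> > a \<and>
    \<rho> * (B1 1 \<omega> - B1 0 \<omega>) + sqrt (1 - \<rho>\<^sup>2) * (B2 1 \<omega> - B2 0 \<omega>) > b)"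
    (is "0 < prob ?D")
proof -
  let ?X = "\<lambda>\<omega>. (B1 1 \<omega> - B1 0 \<omega>) / 1" and ?Y = "\<lambda>\<omega>. (B2 1 \<omega> - B2 0 \<omega>) / 1"
  note [measurable] = B_measurable[of 1, simplified] B_measurable[of 0, simplified]
  obtain p q where pq: "\<And>x y. x \<in> {p<..<p + 1} \<Longrightarrow> y \<in> {q<..<q + 1} \<Longrightarrow>
      a < x \<and> b < \<rho> * x + sqrt (1 - \<rho>\<^sup>2) * y"
  proof (cases "\<rho> = 1")
    case True
    \<comment> \<open>For \<rho> = 1 the second motion has coefficient 0, so only \<open>x\<close>
      is constrained and \<open>q\<close> is arbitrary.\<close>
    then show thesis by (intro that[of "max a b" 0]) auto
  next
    case False
    with assms have "\<rho>\<^sup>2 < 1" by (simp add: abs_square_less_1)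
    then have \<sigma>: "0 < sqrt (1 - \<rho>\<^sup>2)" by simp
    \<comment> \<open>On \<open>{a<..<a + 1}\<close> one has
      \<open>\<bar>x\<bar> \<le> \<bar>a\<bar> + 1\<close>; \<open>q\<close> is chosen so that the
      \<open>y\<close> term exceeds \<open>b\<close> even when the \<open>x\<close> term is as
      negative as this allows.\<close>
    define q where "q = (b + \<bar>\<rho>\<bar> * (\<bar>a\<bar> + 1)) / sqrt (1 - \<rho>\<^sup>2)"
    show thesis
    proof (rule that)
      fix x y assume x: "x \<in> {a<..<a + 1}" and y: "y \<in> {q<..<q + 1}"
      have "\<bar>\<rho> * x\<bar> \<le> \<bar>\<rho>\<bar> * (\<bar>a\<bar> + 1)"
        unfolding abs_mult using x by (intro mult_left_mono) auto
      moreover have "b + \<bar>\<rho>\<bar> * (\<bar>a\<bar> + 1) < sqrt (1 - \<rho>\<^sup>2) * y"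
        using y \<sigma> by (simp add: q_def pos_divide_less_eq mult.commute)
      ultimately show "a < x \<and> b < \<rho> * x + sqrt (1 - \<rho>\<^sup>2) * y" using x by auto
    qed
  qed
  have pos: "0 < prob ((\<lambda>\<omega>. (B 1 \<omega> - B 0 \<omega>) / 1) -` {p<..<p + 1} \<inter> space M)"
    if B: "standard_brownian_motion M B" for B and p :: real
  proof -
    have [measurable]: "B 0 \<in> borel_measurable M" "B 1 \<in> borel_measurable M"
      using B by (auto simp: standard_brownian_motion_def continuous_process_def)
    have "prob ((\<lambda>\<omega>. (B 1 \<omega> - B 0 \<omega>) / 1) -` {p<..<p + 1} \<inter> space M) =
        measure (density lborel std_normal_density) {p<..<p + 1}"
      using distr_increment[OF B, of 0 1, symmetric] by (simp add: measure_distr)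
    \<comment> \<open>The normal density vanishes nowhere, so an interval null for it would be
      Lebesgue null, whereas this one has length 1.\<close>
    moreover have "measure (density lborel std_normal_density) {p<..<p + 1} \<noteq> 0"
    proof
      interpret D: prob_space "density lborel std_normal_density"
        by (rule prob_space_normal_density) simp
      assume "measure (density lborel std_normal_density) {p<..<p + 1} = 0"
      then have "{p<..<p + 1} \<in> null_sets (density lborel std_normal_density)"
        by (auto simp: null_sets_def D.emeasure_eq_measure)
      then have "AE x in lborel. x \<in> {p<..<p + 1} \<longrightarrow> ennreal (std_normal_density x) = 0"
        by (subst (asm) null_sets_density_iff) auto
      then have "AE x in lborel. x \<notin> {p<..<p + 1}"
      proof eventually_elim
        case (elim x)
        then show ?case using normal_density_pos[of 1 0 x] by (auto simp: ennreal_eq_0_iff)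
      qed
      then have "{p<..<p + 1} \<in> null_sets lborel"
        by (subst (asm) AE_iff_null_sets[symmetric]) auto
      then show False by (simp add: null_sets_def)
    qed
    ultimately show ?thesis by (simp add: zero_less_measure_iff)
  qed
  have "0 < prob (?X -` {p<..<p + 1} \<inter> space M) * prob (?Y -` {q<..<q + 1} \<inter> space M)"
    using pos[OF bm1] pos[OF bm2] by (rule mult_pos_pos)
  also have "\<dots> = prob ((\<lambda>\<omega>. (?X \<omega>, ?Y \<omega>)) -` ({p<..<p + 1} \<times> {q<..<q + 1}) \<inter> space M)"
    by (rule indep_varD[OF indep_increments[of 0 1 1], symmetric]) auto
  also have "\<dots> \<le> prob ?D"
  proof (rule finite_measure_mono)
    show "(\<lambda>\<omega>. (?X \<omega>, ?Y \<omega>)) -` ({p<..<p + 1} \<times> {q<..<q + 1}) \<inter> space M \<subseteq> ?D"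
      using pq by auto
    show "?D \<in> events" by measurable
  qed
  finally show ?thesis .
qed

end

section \<open>Transfer between laws and reduction to rational times\<close>

text \<open>Equality of laws on \<open>path_space\<close> transfers only events measurable for the
  product sigma-algebra, and these depend on countably many coordinates. The crossing event must
  therefore first be reduced to rational times.\<close>

lemma process_law_eq_prob:
  assumes law: "process_law N X = process_law M Y"
    and X: "\<And>t. 0 \<le> t \<Longrightarrow> X t \<in> borel_measurable N"
    and Y: "\<And>t. 0 \<le> t \<Longrightarrow> Y t \<in> borel_measurable M"
    and P [measurable]: "Measurable.pred path_space P"
  shows "\<P>(\<omega> in N. P (sample_path X \<omega>)) = \<P>(\<omega> in M. P (sample_path Y \<omega>))"
    and "{\<omega>\<in>space N. P (sample_path X \<omega>)} \<in> sets N"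
    and "{\<omega>\<in>space M. P (sample_path Y \<omega>)} \<in> sets M"
proof -
  have SX [measurable]: "sample_path X \<in> measurable N path_space"
    and SY [measurable]: "sample_path Y \<in> measurable M path_space"
    using X Y by (auto intro!: measurable_restrict)
  define A where "A = {x \<in> space path_space. P x}"
  have A: "A \<in> sets path_space" unfolding A_def by measurable
  have "\<P>(\<omega> in N. P (sample_path X \<omega>)) = measure (process_law N X) A"
    unfolding process_law_def measure_distr[OF SX A]
    by (intro arg_cong[where f = "measure N"]) (auto simp: A_def space_PiM)
  also have "\<dots> = \<P>(\<omega> in M. P (sample_path Y \<omega>))"
    unfolding law unfolding process_law_def measure_distr[OF SY A]
    by (intro arg_cong[where f = "measure M"]) (auto simp: A_def space_PiM)
  finally show "\<P>(\<omega> in N. P (sample_path X \<omega>)) = \<P>(\<omega> in M. P (sample_path Y \<omega>))" .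
  show "{\<omega>\<in>space N. P (sample_path X \<omega>)} \<in> sets N" "{\<omega>\<in>space M. P (sample_path Y \<omega>)} \<in> sets M"
    using measurable_compose[OF SX P] measurable_compose[OF SY P] by (simp_all add: pred_def)
qed

text \<open>The smaller of the two margins is continuous and positive at a crossing time, hence
  positive at nearby rationals. Choosing them below 1 leaves an interval of positive length up to
  time 1 for the scaling argument.\<close>

lemma crossing_iff_rational_crossing:
  fixes x y :: "real \<Rightarrow> real"
  assumes x: "continuous_on {0..} x" and y: "continuous_on {0..} y"
  shows "(\<exists>t\<in>{0..1}. x t - c1 * t > u \<and> y t - c2 * t > v) \<longleftrightarrow>
    (\<exists>t\<in>\<rat> \<inter> {0..<1}. x t - c1 * t > u \<and> y t - c2 * t > v)"
proof
  assume "\<exists>t\<in>{0..1}. x t - c1 * t > u \<and> y t - c2 * t > v"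
  then obtain t where t: "t \<in> {0..1}" "x t - c1 * t > u" "y t - c2 * t > v" by blast
  define m where "m s = min (x s - c1 * s - u) (y s - c2 * s - v)" for s
  have "continuous_on {0..1} m"
    unfolding m_def using x y
    by (intro continuous_intros) (auto intro: continuous_on_subset)
  moreover have "0 < m t" using t by (simp add: m_def)
  ultimately obtain d where d: "d > 0" "\<And>s. s \<in> {0..1} \<Longrightarrow> dist s t < d \<Longrightarrow> dist (m s) (m t) < m t"
    using t(1) unfolding continuous_on_iff by metis
  \<comment> \<open>The neighbourhood of \<open>t\<close> meets the open unit interval even when
    \<open>t\<close> is 0 or 1.\<close>
  have "max 0 (t - d) < min 1 (t + d)" using t(1) d(1) by auto
  then obtain q where q: "q \<in> \<rat>" "max 0 (t - d) < q" "q < min 1 (t + d)"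
    using Rats_dense_in_real by blast
  then have "dist (m q) (m t) < m t" by (intro d(2)) (auto simp: dist_real_def)
  then have "0 < m q" by (auto simp: dist_real_def)
  with q show "\<exists>t\<in>\<rat> \<inter> {0..<1}. x t - c1 * t > u \<and> y t - c2 * t > v"
    by (intro bexI[of _ q]) (auto simp: m_def)
qed auto

section \<open>The two bounds\<close>

theorem proposition1p1:
  fixes M :: "'a measure" and B1 B2 :: "real \<Rightarrow> 'a \<Rightarrow> real"
    and N :: "'b measure" and W1 W2 :: "real \<Rightarrow> 'b \<Rightarrow> real"
    and \<rho> c1 c2 u v :: real
  assumes "standard_brownian_motion M B1"
    and "standard_brownian_motion M B2"
    and "indep_processes M B1 B2"
    and "continuous_process N W1"
    and "continuous_process N W2"
    and "process_law N (\<lambda>t \<omega>. (W1 t \<omega>, W2 t \<omega>)) =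
         process_law M (\<lambda>t \<omega>. (B1 t \<omega>, \<rho> * B1 t \<omega> + sqrt (1 - \<rho>\<^sup>2) * B2 t \<omega>))"
    and "\<rho> \<in> {-1<..1}"
    and "(u, v) \<in> UNIV - {..0} \<times> {..0}"
  shows "\<P>(\<omega> in N. W1 1 \<omega> > u + c1 \<and> W2 1 \<omega> > v + c2) \<le> psi N W1 W2 c1 c2 u v
    \<and> psi N W1 W2 c1 c2 u v \<le>
        \<P>(\<omega> in N. W1 1 \<omega> > u + c1 \<and> W2 1 \<omega> > v + c2)
          / \<P>(\<omega> in N. W1 1 \<omega> > max c1 0 \<and> W2 1 \<omega> > max c2 0)"
proof -
  have "prob_space M"
    using assms(1) by (simp add: standard_brownian_motion_def continuous_process_def)
  then interpret independent_brownian_motions M B1 B2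
    using assms(1-3)
    by (intro independent_brownian_motions.intro independent_brownian_motions_axioms.intro)
  interpret N: prob_space N
    using assms(4) by (simp add: continuous_process_def)
  let ?\<sigma> = "sqrt (1 - \<rho>\<^sup>2)"
  let ?X1 = "\<lambda>t \<omega>. B1 t \<omega> - B1 0 \<omega>"
  let ?X2 = "\<lambda>t \<omega>. \<rho> * (B1 t \<omega> - B1 0 \<omega>) + ?\<sigma> * (B2 t \<omega> - B2 0 \<omega>)"
  let ?Q = "\<rat> \<inter> {0..<1} :: real set"
  have Q: "countable ?Q" by (intro countable_Int1 countable_rat)
  have W [measurable]: "W1 t \<in> borel_measurable N" "W2 t \<in> borel_measurable N" if "0 \<le> t" for t
    using assms(4,5) that by (auto simp: continuous_process_def)
  note B = B_measurable

  \<comment> \<open>The motions start at 0 only almost surely, while the bounds above concern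
    increments from time 0. The exceptional null set is dealt with here once for all path
    events.\<close>
  have transfer: "\<P>(\<omega> in N. P (\<lambda>t\<in>{0..}. (W1 t \<omega>, W2 t \<omega>))) = \<P>(\<omega> in M. P (\<lambda>t\<in>{0..}. (?X1 t \<omega>, ?X2 t \<omega>)))"
    and event: "{\<omega>\<in>space N. P (\<lambda>t\<in>{0..}. (W1 t \<omega>, W2 t \<omega>))} \<in> sets N"
    if P: "Measurable.pred path_space P" for P
  proof -
    note [measurable] = B
    note path = process_law_eq_prob[OF assms(6) _ _ P]
    show "{\<omega>\<in>space N. P (\<lambda>t\<in>{0..}. (W1 t \<omega>, W2 t \<omega>))} \<in> sets N"
      by (rule path(2)) (auto intro!: borel_measurable_Pair W B)
    have "\<P>(\<omega> in N. P (\<lambda>t\<in>{0..}. (W1 t \<omega>, W2 t \<omega>))) =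
        \<P>(\<omega> in M. P (\<lambda>t\<in>{0..}. (B1 t \<omega>, \<rho> * B1 t \<omega> + ?\<sigma> * B2 t \<omega>)))"
      by (rule path(1)) (auto intro!: borel_measurable_Pair borel_measurable_add borel_measurable_times W B)
    also have "\<dots> = \<P>(\<omega> in M. P (\<lambda>t\<in>{0..}. (?X1 t \<omega>, ?X2 t \<omega>)))"
    proof (rule prob_eq_AE)
      have "AE \<omega> in M. B1 0 \<omega> = 0" "AE \<omega> in M. B2 0 \<omega> = 0"
        using assms(1,2) by (auto simp: standard_brownian_motion_def)
      then show "AE \<omega> in M. P (\<lambda>t\<in>{0..}. (B1 t \<omega>, \<rho> * B1 t \<omega> + ?\<sigma> * B2 t \<omega>)) \<longleftrightarrow>
          P (\<lambda>t\<in>{0..}. (?X1 t \<omega>, ?X2 t \<omega>))"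
        by eventually_elim simp
      show "{\<omega>\<in>space M. P (\<lambda>t\<in>{0..}. (B1 t \<omega>, \<rho> * B1 t \<omega> + ?\<sigma> * B2 t \<omega>))} \<in> events"
        by (rule path(3)) (auto intro!: borel_measurable_Pair borel_measurable_add borel_measurable_times W B)
      have "(\<lambda>\<omega>. \<lambda>t\<in>{0..}. (?X1 t \<omega>, ?X2 t \<omega>)) \<in> measurable M path_space"
        by (auto intro!: measurable_restrict borel_measurable_Pair borel_measurable_add
          borel_measurable_times borel_measurable_diff B)
      from measurable_compose[OF this P]
      show "{\<omega>\<in>space M. P (\<lambda>t\<in>{0..}. (?X1 t \<omega>, ?X2 t \<omega>))} \<in> events" by (simp add: pred_def)
    qed
    finally show "\<P>(\<omega> in N. P (\<lambda>t\<in>{0..}. (W1 t \<omega>, W2 t \<omega>))) = \<P>(\<omega> in M. P (\<lambda>t\<in>{0..}. (?X1 t \<omega>, ?X2 t \<omega>)))" .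
  qed

  have comp [measurable]: "(\<lambda>x :: real \<Rightarrow> real \<times> real. fst (x t)) \<in> borel_measurable path_space"
    "(\<lambda>x :: real \<Rightarrow> real \<times> real. snd (x t)) \<in> borel_measurable path_space" if "0 \<le> t" for t
    using that
    by (auto intro!: measurable_compose[OF measurable_component_singleton]
      simp: borel_prod[symmetric])
  have orthant: "\<P>(\<omega> in N. W1 1 \<omega> > a \<and> W2 1 \<omega> > b) = \<P>(\<omega> in M. ?X1 1 \<omega> > a \<and> ?X2 1 \<omega> > b)" for a b
    using transfer[of "\<lambda>x. fst (x 1) > a \<and> snd (x 1) > b"] by simp

  define hit where "hit x \<longleftrightarrow> (\<exists>t\<in>?Q. fst (x t) - c1 * t > u \<and> snd (x t) - c2 * t > v)"
    for x :: "real \<Rightarrow> real \<times> real"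
  have hit: "Measurable.pred path_space hit"
    unfolding hit_def pred_def
  proof (rule sets.sets_Collect_countable_Ex'[OF _ Q])
    fix t :: real assume "t \<in> ?Q"
    then have "0 \<le> t" by simp
    then show "{x \<in> space path_space. fst (x t) - c1 * t > u \<and> snd (x t) - c2 * t > v} \<in> sets path_space"
      by measurable
  qed
  have hit_restrict: "hit (\<lambda>t\<in>{0..}. (f t, g t)) \<longleftrightarrow> (\<exists>t\<in>?Q. f t - c1 * t > u \<and> g t - c2 * t > v)" for f g
    by (auto simp: hit_def)
  \<comment> \<open>Continuity of every path makes this an equality of sets, which also yields
    measurability of the event defining \<open>psi\<close>.\<close>
  have crossing: "{\<omega>\<in>space N. \<exists>t\<in>{0..1}. W1 t \<omega> - c1 * t > u \<and> W2 t \<omega> - c2 * t > v} =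
      {\<omega>\<in>space N. hit (\<lambda>t\<in>{0..}. (W1 t \<omega>, W2 t \<omega>))}"
    unfolding hit_restrict using assms(4,5)
    by (intro Collect_cong conj_cong refl crossing_iff_rational_crossing)
       (auto simp: continuous_process_def)
  have psi: "psi N W1 W2 c1 c2 u v =
      \<P>(\<omega> in M. \<exists>t\<in>?Q. ?X1 t \<omega> - c1 * t > u \<and> ?X2 t \<omega> - c2 * t > v)"
    using transfer[OF hit] unfolding psi_def crossing hit_restrict .

  have lower: "\<P>(\<omega> in N. W1 1 \<omega> > u + c1 \<and> W2 1 \<omega> > v + c2) \<le> psi N W1 W2 c1 c2 u v"
    unfolding psi_def
  proof (rule N.finite_measure_mono)
    show "{\<omega>\<in>space N. \<exists>t\<in>{0..1}. W1 t \<omega> - c1 * t > u \<and> W2 t \<omega> - c2 * t > v} \<in> N.events"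
      unfolding crossing by (rule event[OF hit])
    show "{\<omega>\<in>space N. W1 1 \<omega> > u + c1 \<and> W2 1 \<omega> > v + c2} \<subseteq>
        {\<omega>\<in>space N. \<exists>t\<in>{0..1}. W1 t \<omega> - c1 * t > u \<and> W2 t \<omega> - c2 * t > v}"
    proof safe
      fix \<omega> assume "W1 1 \<omega> > u + c1" "W2 1 \<omega> > v + c2"
      then show "\<exists>t\<in>{0..1}. W1 t \<omega> - c1 * t > u \<and> W2 t \<omega> - c2 * t > v"
        by (intro bexI[of _ 1]) auto
    qed
  qed
  have "psi N W1 W2 c1 c2 u v * \<P>(\<omega> in N. W1 1 \<omega> > max c1 0 \<and> W2 1 \<omega> > max c2 0)
      \<le> \<P>(\<omega> in N. W1 1 \<omega> > u + c1 \<and> W2 1 \<omega> > v + c2)"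
    unfolding psi orthant by (rule countable_crossing_bound[OF Q]) auto
  \<comment> \<open>Positivity turns the product bound into the quotient bound; with a zero
    denominator the quotient would be 0 by convention.\<close>
  moreover have "0 < \<P>(\<omega> in N. W1 1 \<omega> > max c1 0 \<and> W2 1 \<omega> > max c2 0)"
    unfolding orthant using assms(7) by (intro orthant_prob_pos) auto
  ultimately show ?thesis
    using lower by (simp add: pos_le_divide_eq)
qed

end
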